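(* Let $l$ be a positive integer and let $\mathcal{T}=\{(s^{(t)}\,|\,c^{(t)}) : t\in T\}$ be a set of $l$-multipartition data with $s^{(t)}>0$ for at least one $t\in T$. Let $\mathcal{C}_{\mathcal{T}}=\bigcap_{t\in T}\mathcal{C}_{(s^{(t)}\,|\,c^{(t)})}$. Then $\mathcal{C}_{\mathcal{T}}$ is finite if and only if $g(\mathcal{T})=1$.
   Context: A partition is a weakly decreasing sequence of non-negative integers with finite sum. For $l\in\mathbb{N}$, an $l$-multipartition is an $l$-tuple $\lambda=(\lambda^{(1)},\dots,\lambda^{(l)})$ of partitions; $\mathcal{P}^l$ is the set of these and $\varnothing^l$ the multipartition with all components empty. The nodes of $\lambda$ are the triples $(a,b,k)\in\mathbb{N}^2\times\{1,\dots,l\}$ with $b\le\lambda^{(k)}_a$. An $l$-multipartition datum is a pair $(s\,|\,c)$ with $s\in\{0,1,2,\dots\}$ and $c\in\mathbb{Z}^l$. The $(s\,|\,c)$-residue of a node $(a,b,k)$ is $b-a+c_k+s\mathbb{Z}$ (for $s=0$ the integer $b-a+c_k$). The $(s\,|\,c)$-content of $\lambda$ is the multiset of residues of its nodes. $\lambda$ is an $(s\,|\,c)$-core if no other $l$-multipartition has the same $(s\,|\,c)$-content, except that for $s=1$ the set of $(1\,|\,c)$-cores is defined to be $\{\varnothing^l\}$; $\mathcal{C}_{(s|c)}$ denotes the set of $(s\,|\,c)$-cores. $g(\mathcal{T})$ is the greatest common divisor of the integers in $\{s^{(t)}:t\in T\}\cup\{c^{(t)}_i-c^{(t)}_j-c^{(u)}_i+c^{(u)}_j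 : t,u\in T,\ 1\le i,j\le l\}$, with $g(\mathcal{T})=0$ if this set is empty or $\{0\}$. *)

theory Defs
  imports Complex_Main "HOL-Library.Multiset"
begin

text \<open>
  All indices are 0-based: the part \<open>\<lambda>\<^sub>a\<close> with \<open>a \<ge> 1\<close> is \<open>p (a - 1)\<close>, and the components
  of an \<open>l\<close>-tuple are the entries \<open>0, \<dots>, l - 1\<close> of a list of length \<open>l\<close>.
\<close>

type_synonym partition = "nat \<Rightarrow> nat"
type_synonym multipartition = "partition list"
type_synonym mp_datum = "nat \<times> int list"

text \<open>For natural numbers, finite support is the same as finite sum; see
  \<open>partitions_iff_summable\<close> below.\<close>

definition partitions :: "partition set" where
  "partitions = {p. antimono p \<and> finite {i. p i \<noteq> 0}}"

definition multipartitions :: "nat \<Rightarrow> multipartition set" where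
  "multipartitions l = {lam. length lam = l \<and> set lam \<subseteq> partitions}"

definition empty_mp :: "nat \<Rightarrow> multipartition" where
  "empty_mp l = replicate l (\<lambda>_. 0)"

definition mp_data :: "nat \<Rightarrow> mp_datum set" where
  "mp_data l = {(s, c). length c = l}"

text \<open>The triple \<open>(a, b, k)\<close> stands for the node in row \<open>a + 1\<close> and column \<open>b + 1\<close> of
  component \<open>k + 1\<close>; the shift does not change \<open>b - a\<close>.\<close>

definition nodes :: "multipartition \<Rightarrow> (nat \<times> nat \<times> nat) set" where
  "nodes lam = {(a, b, k). k < length lam \<and> b < (lam ! k) a}"

text \<open>Residues are cosets in \<open>\<int> / s\<int>\<close>; for \<open>s = 0\<close> the coset is the singleton of the integer
  \<open>b - a + c\<^sub>k\<close>.\<close>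

definition residue :: "nat \<Rightarrow> int list \<Rightarrow> nat \<times> nat \<times> nat \<Rightarrow> int set" where
  "residue s c = (\<lambda>(a, b, k). {int b - int a + c ! k + int s * m | m. True})"

definition content :: "nat \<Rightarrow> int list \<Rightarrow> multipartition \<Rightarrow> int set multiset" where
  "content s c lam = image_mset (residue s c) (mset_set (nodes lam))"

definition cores :: "nat \<Rightarrow> mp_datum \<Rightarrow> multipartition set" where
  "cores l = (\<lambda>(s, c).
     if s = 1 then {empty_mp l}
     else {lam \<in> multipartitions l.
             \<forall>mu \<in> multipartitions l. content s c mu = content s c lam \<longrightarrow> mu = lam})"

definition simultaneous_cores :: "nat \<Rightarrow> mp_datum set \<Rightarrow> multipartition set" where
  "simultaneous_cores l T = (\<Inter>t\<in>T. cores l t)"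

definition g :: "nat \<Rightarrow> mp_datum set \<Rightarrow> int" where
  "g l T = Gcd ({int s | s c. (s, c) \<in> T} \<union>
     {c ! i - c ! j - d ! i + d ! j | s c r d i j.
        (s, c) \<in> T \<and> (r, d) \<in> T \<and> i < l \<and> j < l})"

lemma partitions_iff_summable:
  "p \<in> partitions \<longleftrightarrow> antimono p \<and> summable (\<lambda>i. real (p i))"
proof -
  have "finite {i. p i \<noteq> 0}" if s: "summable (\<lambda>i. real (p i))"
  proof -
    have "(\<lambda>i. real (p i)) \<longlonglongrightarrow> 0"
      using s by (rule summable_LIMSEQ_zero)
    then have "eventually (\<lambda>i. real (p i) < 1) sequentially"
      by (rule order_tendstoD) simp
    then obtain N where N: "\<And>i. i \<ge> N \<Longrightarrow> real (p i) < 1"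
      unfolding eventually_sequentially by blast
    have "{i. p i \<noteq> 0} \<subseteq> {..<N}"
    proof
      fix i assume "i \<in> {i. p i \<noteq> 0}"
      then show "i \<in> {..<N}"
        using N[of i] by (cases "N \<le> i") auto
    qed
    then show ?thesis
      using finite_subset by blast
  qed
  moreover have "summable (\<lambda>i. real (p i))" if "finite {i. p i \<noteq> 0}"
    by (rule summable_finite[OF that]) simp
  ultimately show ?thesis
    unfolding partitions_def by blast
qed

text \<open>Hence \<open>mset_set\<close> in \<open>content\<close> is only ever applied to finite sets.\<close>

lemma finite_nodes:
  assumes "lam \<in> multipartitions l"
  shows "finite (nodes lam)"
proof -
  have "nodes lam \<subseteq> (\<Union>k<length lam. \<Union>a\<in>{a. (lam ! k) a \<noteq> 0}. (\<lambda>b. (a, b, k)) ` {..<(lam ! k) a})"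
    unfolding nodes_def by force
  moreover have "finite {a. (lam ! k) a \<noteq> 0}" if "k < length lam" for k
    using assms that nth_mem[OF that] unfolding multipartitions_def partitions_def by blast
  ultimately show ?thesis
    by (elim finite_subset) auto
qed

end

theory Submission
  imports Defs "HOL-Library.Infinite_Set" "HOL-Computational_Algebra.Group_Closure"
begin

text \<open>
  Encode a partition by its bead set \<open>{p\<^sub>a - a}\<close> (a Maya diagram of charge 0). A multipartition is
  an \<open>(s|c)\<close>-core iff \<open>y \<in> Y\<^sub>j\<close> implies \<open>y + d \<in> Y\<^sub>i\<close> for all \<open>d \<le> 0\<close> with
  \<open>d \<equiv> c\<^sub>j - c\<^sub>i\<close> modulo \<open>s\<close>. If this fails, two opposite bead moves change the multipartition but
  not its content; if it holds, the bead sets are sublevel sets of a common function, and a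
  Lagrange multiplier argument gives uniqueness.

  If \<open>g \<ge> 2\<close>, then all conditions for the data in \<open>T\<close> follow from those for a single datum of
  modulus \<open>g\<close>, which has infinitely many cores. If \<open>g = 1\<close>, then composing the conditions along
  closed paths shows that every bead set of a common core is closed under all sufficiently large
  downward shifts, which bounds the size of its partition.
\<close>

section \<open>Bead sets\<close>

text \<open>Rows are counted from 0, so the \<open>- 1\<close> makes the negative integers the beads
  of the empty partition.\<close>

definition bead :: "partition \<Rightarrow> nat \<Rightarrow> int" where
  "bead p a = int (p a) - int a - 1"

definition beta :: "partition \<Rightarrow> int set" where
  "beta p = range (bead p)"

text \<open>One count expresses three facts: the set is bounded above, contains all sufficiently
  negative integers, and has charge 0, that is, as many nonnegative members as negative
  gaps.\<close>

definition maya :: "int set \<Rightarrow> bool" where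
  "maya Y \<longleftrightarrow> (\<forall>\<^sub>F A in sequentially. finite (Y \<inter> {- int A..}) \<and> card (Y \<inter> {- int A..}) = A)"

lemma bead_strict_antimono:
  assumes "p \<in> partitions" "a < b"
  shows "bead p b < bead p a"
proof -
  have "p b \<le> p a"
    using assms unfolding partitions_def by (auto dest: antimonoD[of p a b])
  then show ?thesis using assms(2) unfolding bead_def by linarith
qed

lemma inj_bead:
  assumes "p \<in> partitions"
  shows "inj (bead p)"
  by (rule linorder_injI) (metis assms bead_strict_antimono less_irrefl)

lemma partition_eventually_0:
  assumes "p \<in> partitions"
  shows "\<forall>\<^sub>F A in sequentially. \<forall>a\<ge>A. p a = 0"
proof -
  have "finite {i. p i \<noteq> 0}" using assms unfolding partitions_def by auto
  then obtain N where N: "\<And>i. p i \<noteq> 0 \<Longrightarrow> i < N"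
    unfolding finite_nat_set_iff_bounded by auto
  show ?thesis
    unfolding eventually_sequentially
    using N by (metis le_trans not_le)
qed

lemma beta_window:
  assumes "\<forall>a\<ge>A. p a = 0"
  shows "beta p \<inter> {- int A..} = bead p ` {..<A}"
proof -
  have "- int A \<le> bead p a \<longleftrightarrow> a < A" for a
    using assms by (cases "a < A") (auto simp: bead_def)
  then show ?thesis unfolding beta_def by auto
qed

lemma maya_beta:
  assumes "p \<in> partitions"
  shows "maya (beta p)"
  unfolding maya_def using partition_eventually_0[OF assms]
proof eventually_elim
  case (elim A)
  have "inj_on (bead p) {..<A}" using inj_bead[OF assms] by (rule inj_on_subset) simp
  then show ?case by (simp add: beta_window[OF elim] card_image)
qed

lemma image_bead_lessThan:
  assumes "p \<in> partitions"
  shows "bead p ` {..<a} = beta p \<inter> {bead p a<..}"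
proof -
  have "bead p a < bead p b \<longleftrightarrow> b < a" for b
    using bead_strict_antimono[OF assms, of a b] bead_strict_antimono[OF assms, of b a]
    by (cases a b rule: linorder_cases) auto
  then show ?thesis unfolding beta_def by auto
qed

text \<open>The row of a bead is recovered as the number of larger beads; position and row then give
  the part.\<close>

lemma inj_on_beta: "inj_on beta partitions"
proof (rule inj_onI)
  fix p q assume p: "p \<in> partitions" and q: "q \<in> partitions" and eq: "beta p = beta q"
  show "p = q"
  proof
    fix a
    have "bead p a \<in> beta q" using eq unfolding beta_def by auto
    then obtain b where b: "bead p a = bead q b" unfolding beta_def by auto
    then have "bead p ` {..<a} = bead q ` {..<b}"
      using image_bead_lessThan[OF p, of a] image_bead_lessThan[OF q, of b] eq by simp
    moreover have "card (bead p ` {..<a}) = a"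
      using inj_bead[OF p] by (simp add: card_image inj_on_subset)
    moreover have "card (bead q ` {..<b}) = b"
      using inj_bead[OF q] by (simp add: card_image inj_on_subset)
    ultimately have "a = b" by simp
    then show "p a = q a" using b unfolding bead_def by simp
  qed
qed

lemma maya_bdd_above:
  assumes "maya Y"
  obtains B where "\<And>y. y \<in> Y \<Longrightarrow> y \<le> B"
proof -
  obtain A where A: "finite (Y \<inter> {- int A..})"
    using assms unfolding maya_def eventually_sequentially by auto
  let ?B = "Max (insert (- int A) (Y \<inter> {- int A..}))"
  have "y \<le> ?B" if "y \<in> Y" for y
  proof (cases "y \<ge> - int A")
    case True
    then show ?thesis using A that by (intro Max_ge) auto
  next
    case False
    moreover have "- int A \<le> ?B" using A by (intro Max_ge) auto
    ultimately show ?thesis by linarith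
  qed
  then show ?thesis by (rule that)
qed

text \<open>A gap at \<open>- (A + 1)\<close> would make the windows for \<open>A\<close> and
  \<open>A + 1\<close> coincide, although their sizes must differ by one.\<close>

lemma maya_below:
  assumes "maya Y"
  obtains N :: int where "\<And>y. y < N \<Longrightarrow> y \<in> Y"
proof -
  obtain A0 where A0: "\<And>A. A \<ge> A0 \<Longrightarrow> finite (Y \<inter> {- int A..}) \<and> card (Y \<inter> {- int A..}) = A"
    using assms unfolding maya_def eventually_sequentially by auto
  have "y \<in> Y" if y: "y < - int A0" for y
  proof (rule ccontr)
    assume "y \<notin> Y"
    define A where "A = nat (- y) - 1"
    have A: "y = - int (Suc A)" "A \<ge> A0" using y unfolding A_def by auto
    have "Y \<inter> {- int (Suc A)..} = Y \<inter> {- int A..}"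
      using \<open>y \<notin> Y\<close> A by (auto simp: order_le_less)
    moreover have "card (Y \<inter> {- int (Suc A)..}) = Suc A"
      using A0[of "Suc A"] A by simp
    ultimately show False using A0[of A] A by simp
  qed
  then show ?thesis by (rule that)
qed

text \<open>The elements, listed in decreasing order as \<open>y\<close>, yield the parts
  \<open>y a + a + 1\<close>. Strict decrease of integers makes these weakly decreasing.\<close>

lemma maya_imp_beta:
  assumes Y: "maya Y"
  obtains p where "p \<in> partitions" "beta p = Y"
proof -
  obtain B where B: "\<And>y. y \<in> Y \<Longrightarrow> y \<le> B" using maya_bdd_above[OF Y] by blast
  obtain N where N: "\<And>y. y < N \<Longrightarrow> y \<in> Y" using maya_below[OF Y] by blast
  \<comment> \<open>Reflection at the upper bound turns the decreasing listing of \<open>Y\<close>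
    into an increasing enumeration of naturals.\<close>
  define S where "S = {n::nat. B - int n \<in> Y}"
  have "infinite S"
    unfolding infinite_nat_iff_unbounded
  proof
    fix m :: nat
    have "B - int (Suc m + nat (B - N + 1)) \<in> Y" by (rule N) linarith
    then show "\<exists>n>m. n \<in> S" unfolding S_def by (intro exI[of _ "Suc m + nat (B - N + 1)"]) auto
  qed
  define e where "e = enumerate S"
  have e_mono: "strict_mono e" and e_range: "range e = S"
    unfolding e_def using \<open>infinite S\<close> by (auto simp: strict_mono_enumerate range_enumerate)
  define y where "y a = B - int (e a)" for a
  have y_range: "range y = Y"
  proof
    show "range y \<subseteq> Y" using e_range unfolding y_def S_def by auto
    show "Y \<subseteq> range y"
    proof
      fix x assume "x \<in> Y"
      then have "nat (B - x) \<in> S" using B[of x] unfolding S_def by simp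
      then obtain a where "e a = nat (B - x)" using e_range by (metis imageE)
      then have "y a = x" using B[OF \<open>x \<in> Y\<close>] unfolding y_def by simp
      then show "x \<in> range y" by auto
    qed
  qed
  have y_dec: "y b < y a" if "a < b" for a b
    using strict_monoD[OF e_mono that] unfolding y_def by simp
  have y_inj: "inj y" by (rule linorder_injI) (metis y_dec less_irrefl)
  define q where "q a = y a + int a + 1" for a
  have q_anti: "antimono q"
  proof (rule antimonoI)
    fix a b :: nat assume "a \<le> b"
    then show "q b \<le> q a"
    proof (induction rule: dec_induct)
      case (step n)
      then show ?case using y_dec[of n "Suc n"] unfolding q_def by simp
    qed simp
  qed
  obtain K0 where K0: "\<And>K. K \<ge> K0 \<Longrightarrow> finite (Y \<inter> {- int K..}) \<and> card (Y \<inter> {- int K..}) = K"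
    using Y unfolding maya_def eventually_sequentially by auto
  have fin: "finite {a. - int K \<le> y a}" and crd: "card {a. - int K \<le> y a} = K" if "K \<ge> K0" for K
  proof -
    have "y ` {a. - int K \<le> y a} = Y \<inter> {- int K..}" using y_range by auto
    moreover have "inj_on y {a. - int K \<le> y a}" using y_inj by (rule inj_on_subset) simp
    ultimately show "finite {a. - int K \<le> y a}" "card {a. - int K \<le> y a} = K"
      using K0[OF that] by (metis finite_imageD, metis card_image)
  qed
  \<comment> \<open>A positive \<open>q a\<close> would put \<open>a + 1\<close> elements into a
    window of size \<open>a\<close>; a negative one would leave at most \<open>a\<close> elements
    for a window of size \<open>a + 1\<close>.\<close>
  have q0: "q a = 0" if a: "a \<ge> K0" for a
  proof (rule antisym)
    show "q a \<le> 0"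
    proof (rule ccontr)
      assume "\<not> q a \<le> 0"
      then have "- int a \<le> y a" unfolding q_def by simp
      then have "{..a} \<subseteq> {b. - int a \<le> y b}"
        using y_dec[of _ a] by (force simp: order_le_less)
      from card_mono[OF fin[OF a] this] crd[OF a] show False by simp
    qed
    show "0 \<le> q a"
    proof (rule ccontr)
      assume "\<not> 0 \<le> q a"
      then have *: "y a < - int (Suc a)" unfolding q_def by simp
      have "{b. - int (Suc a) \<le> y b} \<subseteq> {..<a}"
      proof
        fix b assume "b \<in> {b. - int (Suc a) \<le> y b}"
        then show "b \<in> {..<a}" using y_dec[of a b] * by (cases a b rule: linorder_cases) auto
      qed
      from card_mono[OF _ this] crd[of "Suc a"] a show False by simp
    qed
  qed
  have q_nonneg: "q a \<ge> 0" for a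
    using antimonoD[OF q_anti, of a "max a K0"] q0[of "max a K0"] by simp
  define p where "p a = nat (q a)" for a
  have "antimono p"
    unfolding p_def using q_anti by (auto simp: antimono_def intro: nat_mono)
  moreover have "{i. p i \<noteq> 0} \<subseteq> {..<K0}"
    using q0 unfolding p_def by (auto simp: not_le[symmetric])
  then have "finite {i. p i \<noteq> 0}" by (rule finite_subset) simp
  ultimately have "p \<in> partitions" unfolding partitions_def by simp
  moreover have "bead p = y"
    unfolding bead_def p_def using q_nonneg by (auto simp: q_def)
  then have "beta p = Y" unfolding beta_def using y_range by simp
  ultimately show ?thesis by (rule that)
qed

text \<open>A window reaching below both positions loses one element and gains one.\<close>

lemma maya_swap:
  assumes Y: "maya Y" and x: "x \<in> Y" and z: "z \<notin> Y"
  shows "maya (insert z (Y - {x}))"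
proof -
  have "\<forall>\<^sub>F A in sequentially. A \<ge> nat (- x) \<and> A \<ge> nat (- z)"
    by (intro eventually_conj eventually_ge_at_top)
  with Y show ?thesis
    unfolding maya_def
  proof eventually_elim
    case (elim A)
    have "insert z (Y - {x}) \<inter> {- int A..} = insert z (Y \<inter> {- int A..} - {x})"
      using elim by auto
    moreover have "A > 0" using elim x card_gt_0_iff[of "Y \<inter> {- int A..}"] by auto
    moreover have "card (Y \<inter> {- int A..} - {x}) = A - 1"
      using elim x by (subst card_Diff_singleton) auto
    ultimately show ?case using elim z by simp
  qed
qed

text \<open>Shifting \<open>Y'\<close> by \<open>d \<le> 0\<close> gives charge \<open>d\<close>,
  whereas a proper superset of \<open>Y\<close> would have positive charge. In windows:
  \<open>A'\<close> would be less than \<open>A\<close>, although \<open>A \<le> A'\<close>.\<close>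

lemma maya_not_psubset_shift:
  assumes Y: "maya Y" and Y': "maya Y'" and d: "d \<le> 0"
    and sub: "Y \<subseteq> (\<lambda>y. y + d) ` Y'" and x: "x \<in> Y'"
  shows "x + d \<in> Y"
proof (rule ccontr)
  assume nx: "x + d \<notin> Y"
  obtain A0 where A0: "\<And>A. A \<ge> A0 \<Longrightarrow> finite (Y \<inter> {- int A..}) \<and> card (Y \<inter> {- int A..}) = A"
    using Y unfolding maya_def eventually_sequentially by auto
  obtain A1 where A1: "\<And>A. A \<ge> A1 \<Longrightarrow> finite (Y' \<inter> {- int A..}) \<and> card (Y' \<inter> {- int A..}) = A"
    using Y' unfolding maya_def eventually_sequentially by auto
  define A where "A = A0 + A1 + nat (- x)"
  define A' where "A' = A + nat (- d)"
  have "Y \<inter> {- int A'..} \<subset> (\<lambda>y. y + d) ` (Y' \<inter> {- int A..})"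
  proof
    show "Y \<inter> {- int A'..} \<subseteq> (\<lambda>y. y + d) ` (Y' \<inter> {- int A..})"
      using sub d unfolding A'_def by force
    have "x + d \<in> (\<lambda>y. y + d) ` (Y' \<inter> {- int A..})" using x unfolding A_def by auto
    with nx show "Y \<inter> {- int A'..} \<noteq> (\<lambda>y. y + d) ` (Y' \<inter> {- int A..})" by auto
  qed
  moreover have "finite (Y' \<inter> {- int A..})" using A1[of A] unfolding A_def by auto
  ultimately have "card (Y \<inter> {- int A'..}) < card ((\<lambda>y. y + d) ` (Y' \<inter> {- int A..}))"
    by (intro psubset_card_mono) auto
  also have "\<dots> \<le> card (Y' \<inter> {- int A..})"
    using \<open>finite (Y' \<inter> {- int A..})\<close> by (rule card_image_le)
  finally show False using A0[of A'] A1[of A] unfolding A'_def A_def by auto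
qed

section \<open>Content and bead sums\<close>

definition step :: "(int \<Rightarrow> int) \<Rightarrow> int \<Rightarrow> int" where
  "step \<theta> x = \<theta> x - \<theta> (x - 1)"

text \<open>For quasi-periodic \<open>\<theta>\<close> the weight \<open>step \<theta>\<close>
  depends only on the residue, so the energy is a linear functional of the content.\<close>

definition energy :: "(int \<Rightarrow> int) \<Rightarrow> int list \<Rightarrow> multipartition \<Rightarrow> int" where
  "energy \<theta> c lam = (\<Sum>(a, b, k)\<in>nodes lam. step \<theta> (int b - int a + c ! k))"

lemma maya_eventually_window:
  fixes Y :: "nat \<Rightarrow> int set"
  assumes "\<And>k. k < l \<Longrightarrow> maya (Y k)"
  shows "\<forall>\<^sub>F A in sequentially. \<forall>k<l. finite (Y k \<inter> {- int A..}) \<and> card (Y k \<inter> {- int A..}) = A"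
proof -
  have "\<forall>\<^sub>F A in sequentially. \<forall>k\<in>{..<l}. finite (Y k \<inter> {- int A..}) \<and> card (Y k \<inter> {- int A..}) = A"
    using assms by (intro eventually_ball_finite) (auto simp: maya_def)
  then show ?thesis by (simp add: Ball_def)
qed

lemma multipartitions_nth:
  assumes "lam \<in> multipartitions l" "k < l"
  shows "lam ! k \<in> partitions"
  using assms unfolding multipartitions_def by auto

lemma maya_beta_nth:
  assumes "lam \<in> multipartitions l" "k < l"
  shows "maya (beta (lam ! k))"
  using maya_beta multipartitions_nth[OF assms] by blast

text \<open>The nodes of a row telescope, leaving the position of its bead and that of the bead of an
  empty row.\<close>

lemma energy_eq:
  assumes lam: "lam \<in> multipartitions l"
  shows "\<forall>\<^sub>F A in sequentially. energy \<theta> c lam =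
    (\<Sum>k<l. (\<Sum>y\<in>beta (lam ! k) \<inter> {- int A..}. \<theta> (y + c ! k)) - (\<Sum>a<A. \<theta> (c ! k - int a - 1)))"
proof -
  have "\<forall>\<^sub>F A in sequentially. \<forall>k\<in>{..<l}. \<forall>a\<ge>A. (lam ! k) a = 0"
    using partition_eventually_0[OF multipartitions_nth[OF lam]]
    by (intro eventually_ball_finite) auto
  then show ?thesis
  proof eventually_elim
    case (elim A)
    have len: "length lam = l" using lam unfolding multipartitions_def by simp
    have nodes: "nodes lam = (\<lambda>(k, a, b). (a, b, k)) `
        (SIGMA k:{..<l}. SIGMA a:{..<A}. {..<(lam ! k) a})"
    proof -
      have "a < A" if "k < l" "b < (lam ! k) a" for a b k
        using elim that by (metis lessThan_iff not_le not_less0)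
      then show ?thesis unfolding nodes_def len by force
    qed
    have "energy \<theta> c lam =
        (\<Sum>k<l. \<Sum>a<A. \<Sum>b<(lam ! k) a. step \<theta> (int b - int a + c ! k))"
      unfolding energy_def nodes
      by (subst sum.reindex) (auto simp: inj_on_def sum.Sigma intro!: sum.cong)
    also have "\<dots> = (\<Sum>k<l. \<Sum>a<A. \<theta> (bead (lam ! k) a + c ! k) - \<theta> (c ! k - int a - 1))"
    proof (intro sum.cong refl)
      fix k a
      have "(\<Sum>b<(lam ! k) a. step \<theta> (int b - int a + c ! k)) =
          (\<Sum>b<(lam ! k) a. \<theta> (int (Suc b) - int a - 1 + c ! k) - \<theta> (int b - int a - 1 + c ! k))"
        by (intro sum.cong) (auto simp: step_def algebra_simps)
      also have "\<dots> = \<theta> (bead (lam ! k) a + c ! k) - \<theta> (c ! k - int a - 1)"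
        by (subst sum_lessThan_telescope[where f = "\<lambda>b. \<theta> (int b - int a - 1 + c ! k)"])
          (simp add: bead_def algebra_simps)
      finally show "(\<Sum>b<(lam ! k) a. step \<theta> (int b - int a + c ! k)) =
        \<theta> (bead (lam ! k) a + c ! k) - \<theta> (c ! k - int a - 1)" .
    qed
    also have "\<dots> = (\<Sum>k<l. (\<Sum>y\<in>beta (lam ! k) \<inter> {- int A..}. \<theta> (y + c ! k)) - (\<Sum>a<A. \<theta> (c ! k - int a - 1)))"
    proof (intro sum.cong refl)
      fix k assume "k \<in> {..<l}"
      then have k: "k < l" by simp
      have "inj_on (bead (lam ! k)) {..<A}"
        using inj_bead[OF multipartitions_nth[OF lam k]] by (rule inj_on_subset) simp
      moreover have "beta (lam ! k) \<inter> {- int A..} = bead (lam ! k) ` {..<A}"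
        by (rule beta_window) (use elim k in auto)
      ultimately have "(\<Sum>y\<in>beta (lam ! k) \<inter> {- int A..}. \<theta> (y + c ! k)) = (\<Sum>a<A. \<theta> (bead (lam ! k) a + c ! k))"
        by (simp add: sum.reindex)
      then show "(\<Sum>a<A. \<theta> (bead (lam ! k) a + c ! k) - \<theta> (c ! k - int a - 1)) =
        (\<Sum>y\<in>beta (lam ! k) \<inter> {- int A..}. \<theta> (y + c ! k)) - (\<Sum>a<A. \<theta> (c ! k - int a - 1))"
        by (simp add: sum_subtractf)
    qed
    finally show ?case .
  qed
qed

section \<open>Quasi-periodic functions and residue classes\<close>

lemma int_fun_const:
  fixes f :: "int \<Rightarrow> 'a"
  assumes "\<And>x. f x = f (x - 1)"
  shows "f x = f y"
proof -
  have "f x = f 0" for x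
  proof (induction x rule: int_induct[where k = 0])
    case (step1 i)
    then show ?case using assms[of "i + 1"] by simp
  next
    case (step2 i)
    then show ?case using assms[of i] by simp
  qed simp
  then show ?thesis by metis
qed

lemma step_antiderivative:
  obtains \<theta> where "step \<theta> = \<psi>"
proof
  \<comment> \<open>The signed sum from 0 to \<open>x\<close>; one of the two sums is always
    empty.\<close>
  define \<theta> where "\<theta> x = (\<Sum>i\<in>{0<..x}. \<psi> i) - (\<Sum>i\<in>{x<..0}. \<psi> i)" for x :: int
  show "step \<theta> = \<psi>"
  proof
    fix x :: int
    show "step \<theta> x = \<psi> x"
    proof (cases "x > 0")
      case True
      then have "{0<..x} = insert x {0<..x - 1}" "{x<..0} = {}" "{x - 1<..0} = {}" by auto
      then show ?thesis unfolding step_def \<theta>_def by simp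
    next
      case False
      then have "{x - 1<..0} = insert x {x<..0}" "{0<..x} = {}" "{0<..x - 1} = {}" by auto
      then show ?thesis unfolding step_def \<theta>_def by simp
    qed
  qed
qed

text \<open>These are the discrete antiderivatives of functions of the residue modulo
  \<open>s\<close>. The drift \<open>\<kappa>\<close> has to be allowed: the level function in the
  uniqueness proof has drift \<open>s\<close>.\<close>

definition quasi_periodic :: "nat \<Rightarrow> (int \<Rightarrow> int) \<Rightarrow> bool" where
  "quasi_periodic s \<theta> \<longleftrightarrow> (\<exists>\<kappa>. \<forall>x. \<theta> (x + int s) = \<theta> x + \<kappa>)"

lemma quasi_periodic_multiple:
  assumes "quasi_periodic s \<theta>"
  obtains \<kappa> where "\<And>x m. \<theta> (x + int s * m) = \<theta> x + \<kappa> * m"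
proof -
  obtain \<kappa> where \<kappa>: "\<And>x. \<theta> (x + int s) = \<theta> x + \<kappa>"
    using assms unfolding quasi_periodic_def by auto
  have "\<theta> (x + int s * m) = \<theta> x + \<kappa> * m" for x m
  proof (induction m rule: int_induct[where k = 0])
    case (step1 i)
    then show ?case using \<kappa>[of "x + int s * i"] by (simp add: algebra_simps)
  next
    case (step2 i)
    then show ?case using \<kappa>[of "x + int s * (i - 1)"] by (simp add: algebra_simps)
  qed simp
  then show ?thesis by (rule that)
qed

lemma quasi_periodic_iff_step:
  "quasi_periodic s \<theta> \<longleftrightarrow> (\<forall>x. step \<theta> (x + int s) = step \<theta> x)"
proof
  assume "quasi_periodic s \<theta>"
  then obtain \<kappa> where \<kappa>: "\<And>x. \<theta> (x + int s) = \<theta> x + \<kappa>"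
    unfolding quasi_periodic_def by auto
  then show "\<forall>x. step \<theta> (x + int s) = step \<theta> x"
    unfolding step_def by (metis add_diff_add add_diff_cancel_right diff_add_eq diff_self minus_diff_eq)
next
  assume *: "\<forall>x. step \<theta> (x + int s) = step \<theta> x"
  have "\<theta> (x + int s) - \<theta> x = \<theta> (x - 1 + int s) - \<theta> (x - 1)" for x
    using *[rule_format, of x] unfolding step_def by (simp add: algebra_simps)
  from int_fun_const[of "\<lambda>x. \<theta> (x + int s) - \<theta> x", OF this]
  have "\<theta> (x + int s) - \<theta> x = \<theta> (0 + int s) - \<theta> 0" for x .
  then show "quasi_periodic s \<theta>" unfolding quasi_periodic_def
    by (intro exI[of _ "\<theta> (0 + int s) - \<theta> 0"]) (simp add: algebra_simps)
qed

definition residue_class :: "nat \<Rightarrow> int \<Rightarrow> int set" where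
  "residue_class s x = {x + int s * m | m. True}"

lemma residue_class_eq_iff: "residue_class s x = residue_class s y \<longleftrightarrow> int s dvd x - y"
proof
  assume "residue_class s x = residue_class s y"
  moreover have "x \<in> residue_class s x" unfolding residue_class_def by (auto intro: exI[of _ 0])
  ultimately show "int s dvd x - y" unfolding residue_class_def by auto
next
  assume "int s dvd x - y"
  then obtain n where n: "x = y + int s * n" by (metis add_diff_cancel_left' diff_add_cancel add.commute dvdE)
  have "x + int s * m = y + int s * (n + m)" "y + int s * m = x + int s * (m - n)" for m
    using n by (auto simp: algebra_simps)
  then show "residue_class s x = residue_class s y" unfolding residue_class_def by blast
qed

lemma residue_eq: "residue s c (a, b, k) = residue_class s (int b - int a + c ! k)"
  unfolding residue_def residue_class_def by simp

text \<open>Each such energy sums a function of the residue over the content; conversely, the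
  antiderivative of the indicator of one residue recovers its multiplicity.\<close>

lemma content_eq_iff_energy:
  assumes lam: "lam \<in> multipartitions l" and mu: "mu \<in> multipartitions l"
  shows "content s c mu = content s c lam \<longleftrightarrow>
    (\<forall>\<theta>. quasi_periodic s \<theta> \<longrightarrow> energy \<theta> c mu = energy \<theta> c lam)"
proof
  assume eq: "content s c mu = content s c lam"
  show "\<forall>\<theta>. quasi_periodic s \<theta> \<longrightarrow> energy \<theta> c mu = energy \<theta> c lam"
  proof (intro allI impI)
    fix \<theta> assume qp: "quasi_periodic s \<theta>"
    define F where "F R = step \<theta> (SOME x. x \<in> R)" for R
    have F: "F (residue_class s x) = step \<theta> x" for x
    proof -
      obtain \<kappa> where \<kappa>: "\<And>x m. \<theta> (x + int s * m) = \<theta> x + \<kappa> * m"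
        using quasi_periodic_multiple[OF qp] by blast
      have "(SOME y. y \<in> residue_class s x) \<in> residue_class s x"
        by (rule someI[of _ x]) (auto simp: residue_class_def intro: exI[of _ 0])
      then obtain m where m: "(SOME y. y \<in> residue_class s x) = x + int s * m"
        unfolding residue_class_def by auto
      show ?thesis using \<kappa>[of x m] \<kappa>[of "x - 1" m]
        unfolding F_def m step_def by (simp add: algebra_simps)
    qed
    have "energy \<theta> c nu = sum_mset (image_mset F (content s c nu))" for nu
      unfolding energy_def content_def
      by (simp add: image_mset.compositionality comp_def sum_unfold_sum_mset residue_eq F case_prod_unfold
          flip: F)
        (auto intro!: arg_cong[where f = sum_mset] image_mset_cong simp: residue_eq)
    then show "energy \<theta> c mu = energy \<theta> c lam" using eq by simp
  qed
next
  assume *: "\<forall>\<theta>. quasi_periodic s \<theta> \<longrightarrow> energy \<theta> c mu = energy \<theta> c lam"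
  show "content s c mu = content s c lam"
  proof (rule multiset_eqI)
    fix R
    obtain \<theta> where \<theta>: "step \<theta> = (\<lambda>x. of_bool (residue_class s x = R))"
      using step_antiderivative by blast
    have "residue_class s (x + int s) = residue_class s x" for x
      by (simp add: residue_class_eq_iff)
    then have "quasi_periodic s \<theta>" unfolding quasi_periodic_iff_step \<theta> by simp
    have "int (count (content s c nu) R) = energy \<theta> c nu" if "nu \<in> multipartitions l" for nu
    proof -
      have fin: "finite (nodes nu)" using finite_nodes[OF that] .
      have "count (content s c nu) R = card {n \<in> nodes nu. residue s c n = R}"
        unfolding content_def using fin
        by (simp add: count_image_mset vimage_def Int_def sum.inter_filter flip: card_eq_sum)
          (simp add: conj_commute)
      also have "int \<dots> = (\<Sum>n\<in>nodes nu. of_bool (residue s c n = R))"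
        using fin by (simp add: of_bool_def sum.If_cases Int_def)
      also have "\<dots> = energy \<theta> c nu"
        unfolding energy_def \<theta> by (intro sum.cong) (auto simp: residue_eq)
      finally show ?thesis .
    qed
    with * lam mu \<open>quasi_periodic s \<theta>\<close>
    have "int (count (content s c mu) R) = int (count (content s c lam) R)" by auto
    then show "count (content s c mu) R = count (content s c lam) R" by simp
  qed
qed

text \<open>In a window containing both positions, one summand is exchanged for another. The bead
  may move in either direction.\<close>

lemma move_bead:
  assumes lam: "lam \<in> multipartitions l" and k: "k < l"
    and x: "x \<in> beta (lam ! k)" and z: "z \<notin> beta (lam ! k)"
  obtains mu where "mu \<in> multipartitions l"
    "beta (mu ! k) = insert z (beta (lam ! k) - {x})"
    "\<And>j. j \<noteq> k \<Longrightarrow> mu ! j = lam ! j"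
    "\<And>\<theta>. energy \<theta> c mu = energy \<theta> c lam + \<theta> (z + c ! k) - \<theta> (x + c ! k)"
proof -
  have "maya (insert z (beta (lam ! k) - {x}))"
    using maya_swap[OF maya_beta_nth[OF lam k] x z] .
  then obtain p where p: "p \<in> partitions" "beta p = insert z (beta (lam ! k) - {x})"
    using maya_imp_beta by blast
  define mu where "mu = lam[k := p]"
  have len: "length lam = l" using lam unfolding multipartitions_def by simp
  have mu: "mu \<in> multipartitions l"
    using lam p(1) set_update_subset_insert[of lam k p]
    unfolding multipartitions_def mu_def by auto
  have energy: "energy \<theta> c mu = energy \<theta> c lam + \<theta> (z + c ! k) - \<theta> (x + c ! k)" for \<theta>
  proof -
    have "\<forall>\<^sub>F A in sequentially. A \<ge> nat (- x) \<and> A \<ge> nat (- z)"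
      by (intro eventually_conj eventually_ge_at_top)
    moreover have "\<forall>\<^sub>F A in sequentially. finite (beta (lam ! k) \<inter> {- int A..})"
      using maya_beta_nth[OF lam k] unfolding maya_def by (rule eventually_mono) simp
    ultimately have "\<forall>\<^sub>F A in sequentially.
      energy \<theta> c mu = energy \<theta> c lam + \<theta> (z + c ! k) - \<theta> (x + c ! k)"
      using energy_eq[OF lam, of \<theta> c] energy_eq[OF mu, of \<theta> c]
    proof eventually_elim
      case (elim A)
      let ?W = "\<lambda>nu j. (\<Sum>y\<in>beta (nu ! j) \<inter> {- int A..}. \<theta> (y + c ! j))"
      let ?U = "\<lambda>j. (\<Sum>a<A. \<theta> (c ! j - int a - 1))"
      let ?V = "beta (lam ! k) \<inter> {- int A..}"
      have "beta (mu ! k) \<inter> {- int A..} = insert z (?V - {x})"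
        using elim(1) k len p(2) unfolding mu_def by auto
      then have "?W mu k = \<theta> (z + c ! k) + (\<Sum>y\<in>?V - {x}. \<theta> (y + c ! k))"
        using elim(2) z by simp
      also have "(\<Sum>y\<in>?V - {x}. \<theta> (y + c ! k)) = ?W lam k - \<theta> (x + c ! k)"
        using elim(1,2) x by (subst sum_diff1) auto
      finally have Wk: "?W mu k - ?U k = ?W lam k - ?U k + (\<theta> (z + c ! k) - \<theta> (x + c ! k))" by simp
      have "(\<Sum>j\<in>{..<l} - {k}. ?W mu j - ?U j) = (\<Sum>j\<in>{..<l} - {k}. ?W lam j - ?U j)"
        by (intro sum.cong) (auto simp: mu_def)
      then show ?case
        using Wk elim(3,4) k
          sum.remove[of "{..<l}" k "\<lambda>j. ?W mu j - ?U j"]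
          sum.remove[of "{..<l}" k "\<lambda>j. ?W lam j - ?U j"] by simp
    qed
    then show ?thesis by simp
  qed
  show ?thesis
    by (rule that[OF mu _ _ energy]) (use k len p(2) in \<open>auto simp: mu_def\<close>)
qed

section \<open>Cores and nestedness\<close>

text \<open>With \<open>X\<^sub>k\<close> the bead set of component \<open>k\<close> shifted by
  \<open>c\<^sub>k\<close>, the translates \<open>X\<^sub>k + s m\<close> are to form a chain under
  inclusion, ordered by the charges \<open>c\<^sub>k + s m\<close>.\<close>

definition nested :: "nat \<Rightarrow> int list \<Rightarrow> multipartition \<Rightarrow> bool" where
  "nested s c lam \<longleftrightarrow> (\<forall>i<length lam. \<forall>j<length lam. \<forall>d\<le>0. int s dvd d - (c ! j - c ! i) \<longrightarrow>
     (\<forall>y\<in>beta (lam ! j). y + d \<in> beta (lam ! i)))"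

text \<open>From a violation at \<open>y\<close>, bead \<open>w\<close> of component
  \<open>i\<close> moves to \<open>y + d\<close> and bead \<open>y\<close> of component
  \<open>j\<close> moves to \<open>w - d\<close>. After shifting by the charges, the two positions
  are merely swapped, up to \<open>s m\<close> and \<open>- s m\<close>.\<close>

lemma content_nonunique_if_not_nested:
  assumes lam: "lam \<in> multipartitions l" and s: "s \<noteq> 1" and nn: "\<not> nested s c lam"
  shows "\<exists>mu\<in>multipartitions l. content s c mu = content s c lam \<and> mu \<noteq> lam"
proof -
  have len: "length lam = l" using lam unfolding multipartitions_def by simp
  obtain i j d y where ij: "i < l" "j < l" and d: "d \<le> 0" "int s dvd d - (c ! j - c ! i)"
    and y: "y \<in> beta (lam ! j)" "y + d \<notin> beta (lam ! i)"
    using nn unfolding nested_def len by auto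
  obtain m where m: "d = c ! j - c ! i + int s * m"
    using d(2) by (metis add.commute diff_add_cancel dvdE)
  \<comment> \<open>For \<open>i \<noteq> j\<close>, equality of the charges provides
    \<open>w\<close>. Within one component, \<open>w\<close> must also be incongruent to
    \<open>y\<close> modulo \<open>d\<close>, lest the two moves collide.\<close>
  have "\<exists>w. w \<in> beta (lam ! i) \<and> w - d \<notin> beta (lam ! j) \<and> (i = j \<longrightarrow> \<not> d dvd w - y)"
  proof (cases "i = j")
    case False
    have "\<not> beta (lam ! i) \<subseteq> (\<lambda>y. y + d) ` beta (lam ! j)"
      using maya_not_psubset_shift[OF maya_beta_nth[OF lam ij(1)] maya_beta_nth[OF lam ij(2)] d(1) _ y(1)] y(2)
      by blast
    then obtain w where "w \<in> beta (lam ! i)" "w \<notin> (\<lambda>y. y + d) ` beta (lam ! j)" by blast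
    then have "w - d \<notin> beta (lam ! j)" by (metis diff_add_cancel imageI)
    then show ?thesis using False \<open>w \<in> beta (lam ! i)\<close> by blast
  next
    case True
    have "d \<noteq> 0" using y True by auto
    moreover have "int s dvd d" using d(2) True by simp
    \<comment> \<open>Here \<open>s \<noteq> 1\<close> enters: once \<open>d \<le> - 2\<close>, the
      class of \<open>y + 1\<close> modulo \<open>d\<close> differs from that of
      \<open>y\<close>.\<close>
    ultimately have "d \<noteq> - 1" using s by auto
    with \<open>d \<noteq> 0\<close> d(1) have d2: "d \<le> - 2" by simp
    let ?Y = "beta (lam ! i)"
    obtain B where B: "\<And>x. x \<in> ?Y \<Longrightarrow> x \<le> B" using maya_bdd_above[OF maya_beta_nth[OF lam ij(1)]] by blast
    obtain N where N: "\<And>x. x < N \<Longrightarrow> x \<in> ?Y" using maya_below[OF maya_beta_nth[OF lam ij(1)]] by blast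
    define n where "n = nat \<bar>y + 1 - N\<bar> + 1"
    have "int n \<le> - d * int n" using d2 by (intro mult_le_cancel_right1[THEN iffD2]) auto
    then have n: "y + 1 + d * int n \<in> ?Y"
      by (intro N) (simp add: n_def)
    \<comment> \<open>The largest bead congruent to \<open>y + 1\<close> modulo \<open>d\<close> has
      a gap at distance \<open>- d\<close> above it. The lower bound keeps the set finite.\<close>
    define S where "S = {x \<in> ?Y. d dvd x - (y + 1) \<and> y + 1 + d * int n \<le> x}"
    have "finite S" by (rule finite_subset[of _ "{y + 1 + d * int n..B}"]) (auto simp: S_def B)
    moreover have "y + 1 + d * int n \<in> S" using n unfolding S_def by auto
    ultimately have max: "Max S \<in> S" "\<And>x. x \<in> S \<Longrightarrow> x \<le> Max S" by (auto intro: Max_in)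
    have "Max S - d \<notin> ?Y"
    proof
      assume "Max S - d \<in> ?Y"
      moreover have "d dvd Max S - d - (y + 1)"
        using max(1) dvd_diff[of d "Max S - (y + 1)" d] unfolding S_def by (simp add: algebra_simps)
      ultimately have "Max S - d \<in> S" using max(1) d2 unfolding S_def by auto
      then show False using max(2) d2 by fastforce
    qed
    moreover have "\<not> d dvd Max S - y"
    proof
      assume "d dvd Max S - y"
      moreover have "d dvd Max S - (y + 1)" using max(1) unfolding S_def by simp
      ultimately have "d dvd (Max S - y) - (Max S - (y + 1))" by (rule dvd_diff)
      then show False using d2 by (auto simp: zdvd_not_zless dest: zdvd_imp_le)
    qed
    ultimately show ?thesis using max(1) True unfolding S_def by blast
  qed
  then obtain w where w: "w \<in> beta (lam ! i)" "w - d \<notin> beta (lam ! j)" "i = j \<Longrightarrow> \<not> d dvd w - y"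
    by blast
  \<comment> \<open>\<open>w = y\<close> would take the same bead twice;
    \<open>w - d = y + d\<close> would put two beads on one position.\<close>
  have wy: "w \<noteq> y" "w - d \<noteq> y + d" if "i = j"
  proof -
    show "w \<noteq> y" using w(3)[OF that] by auto
    show "w - d \<noteq> y + d"
    proof
      assume "w - d = y + d"
      then have "w - y = d * 2" by simp
      then show False using w(3)[OF that] by simp
    qed
  qed
  obtain nu where nu: "nu \<in> multipartitions l" "beta (nu ! i) = insert (y + d) (beta (lam ! i) - {w})"
    "\<And>k. k \<noteq> i \<Longrightarrow> nu ! k = lam ! k"
    "\<And>\<theta>. energy \<theta> c nu = energy \<theta> c lam + \<theta> (y + d + c ! i) - \<theta> (w + c ! i)"
    using move_bead[OF lam ij(1) w(1) y(2), of c] by blast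
  have yw: "y \<in> beta (nu ! j)" "w - d \<notin> beta (nu ! j)"
    using nu(2,3) y(1) w(2) wy by (cases "i = j"; auto)+
  obtain mu where mu: "mu \<in> multipartitions l" "beta (mu ! j) = insert (w - d) (beta (nu ! j) - {y})"
    "\<And>k. k \<noteq> j \<Longrightarrow> mu ! k = nu ! k"
    "\<And>\<theta>. energy \<theta> c mu = energy \<theta> c nu + \<theta> (w - d + c ! j) - \<theta> (y + c ! j)"
    using move_bead[OF nu(1) ij(2) yw, of c] by blast
  have "mu \<noteq> lam"
    using mu(2) w(2) by auto
  moreover have "energy \<theta> c mu = energy \<theta> c lam" if "quasi_periodic s \<theta>" for \<theta>
  proof -
    obtain \<kappa> where \<kappa>: "\<And>x m. \<theta> (x + int s * m) = \<theta> x + \<kappa> * m"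
      using quasi_periodic_multiple[OF \<open>quasi_periodic s \<theta>\<close>] by blast
    \<comment> \<open>The same multiple of \<open>s\<close> occurs twice, with opposite signs in the
      energy, so the drift cancels.\<close>
    have "y + d + c ! i = y + c ! j + int s * m" "w + c ! i = w - d + c ! j + int s * m"
      using m by auto
    then show ?thesis unfolding mu(4)[of \<theta>] nu(4)[of \<theta>] by (simp only: \<kappa>)
  qed
  ultimately show ?thesis using content_eq_iff_energy[OF lam mu(1)] mu(1) by blast
qed

text \<open>The level of \<open>x\<close> is the least charge \<open>c\<^sub>k + s m\<close> of a translate \<open>X\<^sub>k + s m\<close> containing \<open>x\<close>,
  where \<open>X\<^sub>k\<close> is the bead set of component \<open>k\<close> shifted by \<open>c\<^sub>k\<close>. No translate contains \<open>x\<close> only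
  if \<open>s = 0\<close>, and then any value above all charges serves.\<close>

lemma nested_level:
  assumes lam: "lam \<in> multipartitions l" and c: "length c = l" and l: "l > 0" and nest: "nested s c lam"
  obtains \<theta> where "\<And>x. \<theta> (x + int s) = \<theta> x + int s"
    "\<And>k y. k < l \<Longrightarrow> y \<in> beta (lam ! k) \<longleftrightarrow> \<theta> (y + c ! k) \<le> c ! k"
proof -
  have len: "length lam = l" using lam unfolding multipartitions_def by simp
  \<comment> \<open>The charges of all translates containing \<open>x\<close>; by nestedness every
    translate of larger charge contains \<open>x\<close> as well.\<close>
  define S where "S x = {c ! k + int s * m | k m. k < l \<and> x - int s * m - c ! k \<in> beta (lam ! k)}" for x
  have up: "x - int s * m' - c ! k \<in> beta (lam ! k)" if v: "v \<in> S x" and le: "v \<le> c ! k + int s * m'" and k: "k < l"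
    for x v k m'
  proof -
    obtain j m where jm: "j < l" "v = c ! j + int s * m" "x - int s * m - c ! j \<in> beta (lam ! j)"
      using v unfolding S_def by auto
    let ?d = "c ! j + int s * m - (c ! k + int s * m')"
    have "int s dvd ?d - (c ! j - c ! k)"
      by (rule dvdI[of _ _ "m - m'"]) (simp add: algebra_simps)
    then have "(x - int s * m - c ! j) + ?d \<in> beta (lam ! k)"
      using nest jm le k unfolding nested_def len by (metis diff_le_0_iff_le)
    then show ?thesis by (simp add: algebra_simps)
  qed
  have shift: "S (x + int s) = (\<lambda>v. v + int s) ` S x" for x
  proof
    show "S (x + int s) \<subseteq> (\<lambda>v. v + int s) ` S x"
    proof
      fix v assume "v \<in> S (x + int s)"
      then obtain k m where "k < l" "v = c ! k + int s * m" "x + int s - int s * m - c ! k \<in> beta (lam ! k)"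
        unfolding S_def by auto
      then have "c ! k + int s * (m - 1) \<in> S x" "v = c ! k + int s * (m - 1) + int s"
        unfolding S_def by (auto intro!: exI[of _ k] exI[of _ "m - 1"] simp: algebra_simps)
      then show "v \<in> (\<lambda>v. v + int s) ` S x" by blast
    qed
    show "(\<lambda>v. v + int s) ` S x \<subseteq> S (x + int s)"
    proof
      fix v assume "v \<in> (\<lambda>v. v + int s) ` S x"
      then obtain k m where "k < l" "v = c ! k + int s * m + int s" "x - int s * m - c ! k \<in> beta (lam ! k)"
        unfolding S_def by auto
      then show "v \<in> S (x + int s)"
        unfolding S_def by (auto intro!: exI[of _ k] exI[of _ "m + 1"] simp: algebra_simps)
    qed
  qed
  have nonempty: "S x \<noteq> {}" if "s > 0" for x
  proof -
    obtain N where N: "\<And>y. y < N \<Longrightarrow> y \<in> beta (lam ! 0)"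
      using maya_below[OF maya_beta_nth[OF lam l]] by blast
    let ?m = "\<bar>x - c ! 0 - N\<bar> + 1"
    have "?m \<le> int s * ?m" using that mult_right_mono[of 1 "int s" ?m] by simp
    then have "x - int s * ?m - c ! 0 \<in> beta (lam ! 0)"
      by (intro N) linarith
    then show ?thesis unfolding S_def using l by blast
  qed
  have least: "\<exists>v\<in>S x. \<forall>u\<in>S x. v \<le> u" if ne: "S x \<noteq> {}" for x
  proof -
    have "\<exists>B. \<forall>k\<in>{..<l}. \<forall>y\<in>beta (lam ! k). y \<le> B"
    proof -
      have "\<exists>B. \<forall>y\<in>beta (lam ! k). y \<le> B" if "k < l" for k
        using maya_bdd_above[OF maya_beta_nth[OF lam that]] by metis
      then obtain b where b: "\<And>k. k < l \<Longrightarrow> \<forall>y\<in>beta (lam ! k). y \<le> b k" by metis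
      have "b k \<le> Max (b ` {..<l})" if "k < l" for k using that by simp
      with b show ?thesis by (meson lessThan_iff order_trans)
    qed
    then obtain B where B: "\<And>k y. k < l \<Longrightarrow> y \<in> beta (lam ! k) \<Longrightarrow> y \<le> B" by blast
    \<comment> \<open>The upper bound on all beads bounds these charges from below, so a least one
      exists.\<close>
    have low: "x - B \<le> u" if "u \<in> S x" for u
      using that B unfolding S_def by fastforce
    obtain u where u: "u \<in> S x" using ne by blast
    define F where "F = {v \<in> S x. v \<le> u}"
    have "finite F" by (rule finite_subset[of _ "{x - B..u}"]) (auto simp: F_def low)
    moreover have "F \<noteq> {}" using u by (auto simp: F_def)
    ultimately have "Min F \<in> F" "\<And>v. v \<in> F \<Longrightarrow> Min F \<le> v" by (auto intro: Min_in)
    moreover have "Min F \<le> v" if "v \<in> S x" for v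
    proof (cases "v \<le> u")
      case True
      then show ?thesis using calculation(2) that unfolding F_def by blast
    next
      case False
      then show ?thesis using calculation(1) unfolding F_def by auto
    qed
    ultimately show ?thesis unfolding F_def by blast
  qed
  define \<theta> where "\<theta> x = (if S x = {} then Max (set c) + 1 else Inf (S x))" for x
  have \<theta>: "\<theta> x \<in> S x" "\<And>u. u \<in> S x \<Longrightarrow> \<theta> x \<le> u" if ne: "S x \<noteq> {}" for x
  proof -
    obtain v where v: "v \<in> S x" "\<And>u. u \<in> S x \<Longrightarrow> v \<le> u" using least[OF ne] by blast
    then have "\<theta> x = v" unfolding \<theta>_def using ne by (simp add: cInf_eq_minimum)
    then show "\<theta> x \<in> S x" "\<And>u. u \<in> S x \<Longrightarrow> \<theta> x \<le> u" using v by auto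
  qed
  show ?thesis
  proof
    fix x show "\<theta> (x + int s) = \<theta> x + int s"
    proof (cases "s > 0")
      case True
      have "\<theta> x + int s \<in> S (x + int s)" "\<theta> (x + int s) \<in> (\<lambda>v. v + int s) ` S x"
        using \<theta>(1) nonempty[OF True] shift by blast+
      then have "\<theta> (x + int s) \<le> \<theta> x + int s" "\<theta> x + int s \<le> \<theta> (x + int s)"
        using \<theta>(2) nonempty[OF True] by fastforce+
      then show ?thesis by simp
    qed simp
  next
    fix k y assume k: "k < l"
    show "y \<in> beta (lam ! k) \<longleftrightarrow> \<theta> (y + c ! k) \<le> c ! k"
    proof
      assume "y \<in> beta (lam ! k)"
      then have "c ! k \<in> S (y + c ! k)"
        unfolding S_def using k by (intro CollectI exI[of _ k] exI[of _ 0]) simp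
      then show "\<theta> (y + c ! k) \<le> c ! k" using \<theta>(2) by blast
    next
      assume le: "\<theta> (y + c ! k) \<le> c ! k"
      have "S (y + c ! k) \<noteq> {}"
      proof
        assume "S (y + c ! k) = {}"
        then have "Max (set c) + 1 \<le> c ! k" using le unfolding \<theta>_def by simp
        moreover have "c ! k \<le> Max (set c)" using k c by simp
        ultimately show False by simp
      qed
      from up[OF \<theta>(1)[OF this], of k 0] le k show "y \<in> beta (lam ! k)" by simp
    qed
  qed
qed

text \<open>\<open>V - W\<close> and \<open>W - V\<close> have equally many elements, with
  \<open>f\<close> at least \<open>t + 1\<close> on the former and at most \<open>t\<close> on the
  latter. Each replaced element therefore costs at least 1.\<close>

lemma sum_sublevel_minimal:
  fixes f :: "'a \<Rightarrow> int"
  assumes fin: "finite W" "finite V" and card: "card W = card V"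
    and W: "\<And>x. x \<in> W \<Longrightarrow> f x \<le> t" and V: "\<And>x. x \<in> V - W \<Longrightarrow> t < f x"
  shows "sum f W \<le> sum f V" "sum f W = sum f V \<Longrightarrow> W = V"
proof -
  have cd: "card (W - V) = card (V - W)"
    using fin card by (metis Int_commute card_Diff_subset_Int finite_Int)
  have sums: "sum f W = sum f (W \<inter> V) + sum f (W - V)" "sum f V = sum f (W \<inter> V) + sum f (V - W)"
    using fin by (metis sum.Int_Diff, metis Int_commute sum.Int_Diff)
  have low: "sum f (W - V) \<le> int (card (W - V)) * t"
    using W by (intro sum_bounded_above[THEN order_trans]) auto
  have "int (card (V - W)) * (t + 1) \<le> sum f (V - W)"
    using V by (intro sum_bounded_below[THEN order_trans[rotated]]) (auto simp: add1_zle_eq)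
  then have le: "sum f W + int (card (V - W)) \<le> sum f V"
    using sums low cd by (simp add: algebra_simps)
  then show "sum f W \<le> sum f V" by simp
  assume "sum f W = sum f V"
  with le have "card (V - W) = 0" by simp
  then have "V \<subseteq> W" using fin by auto
  with card fin show "W = V" by (metis card_subset_eq)
qed

text \<open>For the level \<open>\<theta>\<close> of a nested multipartition, the total of \<open>\<theta>(x)\<close> over the beads \<open>x\<close> is
  determined by the content, and the components being sublevel sets of \<open>\<theta>\<close> are its only
  minimizers among bead sets of the same charges.\<close>

lemma content_unique_if_nested:
  assumes lam: "lam \<in> multipartitions l" and c: "length c = l" and l: "l > 0" and nest: "nested s c lam"
    and mu: "mu \<in> multipartitions l" and eq: "content s c mu = content s c lam"
  shows "mu = lam"
proof -
  obtain \<theta> where \<theta>: "\<And>x. \<theta> (x + int s) = \<theta> x + int s"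
    "\<And>k y. k < l \<Longrightarrow> y \<in> beta (lam ! k) \<longleftrightarrow> \<theta> (y + c ! k) \<le> c ! k"
    using nested_level[OF lam c l nest] by blast
  have "quasi_periodic s \<theta>" using \<theta>(1) unfolding quasi_periodic_def by blast
  then have energy: "energy \<theta> c mu = energy \<theta> c lam"
    using eq content_eq_iff_energy[OF lam mu] by blast
  have window: "\<forall>\<^sub>F A in sequentially. \<forall>k<l. finite (beta (nu ! k) \<inter> {- int A..}) \<and>
      card (beta (nu ! k) \<inter> {- int A..}) = A" if "nu \<in> multipartitions l" for nu
    by (rule maya_eventually_window) (rule maya_beta_nth[OF that])
  have "\<forall>\<^sub>F A in sequentially. \<forall>k<l. beta (lam ! k) \<inter> {- int A..} = beta (mu ! k) \<inter> {- int A..}"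
    using energy_eq[OF lam, of \<theta> c] energy_eq[OF mu, of \<theta> c] window[OF lam] window[OF mu]
  proof eventually_elim
    case (elim A)
    let ?W = "\<lambda>nu j. (\<Sum>y\<in>beta (nu ! j) \<inter> {- int A..}. \<theta> (y + c ! j))"
    have sums: "(\<Sum>k<l. ?W lam k) = (\<Sum>k<l. ?W mu k)"
      using elim(1,2) energy by (simp add: sum_subtractf)
    have *: "?W lam k \<le> ?W mu k"
      "?W lam k = ?W mu k \<Longrightarrow> beta (lam ! k) \<inter> {- int A..} = beta (mu ! k) \<inter> {- int A..}" if k: "k < l" for k
      using elim(3,4) k \<theta>(2)[OF k]
      by (intro sum_sublevel_minimal[where t = "c ! k"]; auto)+
    have "?W lam k = ?W mu k" if k: "k < l" for k
    proof (rule ccontr)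
      assume "?W lam k \<noteq> ?W mu k"
      then have "?W lam k < ?W mu k" using *(1)[OF k] by simp
      then have "(\<Sum>k<l. ?W lam k) < (\<Sum>k<l. ?W mu k)"
        using k *(1) by (intro sum_strict_mono_ex1) auto
      then show False using sums by simp
    qed
    then show ?case using *(2) by blast
  qed
  then obtain A0 where A0: "\<And>A k. A \<ge> A0 \<Longrightarrow> k < l \<Longrightarrow> beta (lam ! k) \<inter> {- int A..} = beta (mu ! k) \<inter> {- int A..}"
    unfolding eventually_sequentially by blast
  have "beta (mu ! k) = beta (lam ! k)" if "k < l" for k
  proof (rule set_eqI)
    fix x
    have "x \<ge> - int (A0 + nat (- x))" by simp
    then show "x \<in> beta (mu ! k) \<longleftrightarrow> x \<in> beta (lam ! k)"
      using A0[of "A0 + nat (- x)" k] that by (metis IntD1 IntI atLeast_iff le_add1)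
  qed
  then have "mu ! k = lam ! k" if "k < l" for k
    using that inj_onD[OF inj_on_beta] multipartitions_nth lam mu by blast
  moreover have "length mu = l" "length lam = l" using lam mu unfolding multipartitions_def by auto
  ultimately show ?thesis by (simp add: nth_equalityI)
qed

section \<open>The convention for modulus 1 and the criterion for cores\<close>

lemma beta_0: "beta (\<lambda>_. 0) = {..<0}"
proof -
  have "x \<in> range (bead (\<lambda>_. 0))" if "x < 0" for x
    using that by (intro image_eqI[of _ _ "nat (- x - 1)"]) (auto simp: bead_def)
  then show ?thesis unfolding beta_def by (auto simp: bead_def)
qed

text \<open>A downward closed set is comparable with \<open>{..<0}\<close>, and comparable sets of
  equal charge coincide.\<close>

lemma maya_downward_closed:
  assumes Y: "maya Y" and down: "\<And>y. y \<in> Y \<Longrightarrow> y - 1 \<in> Y"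
  shows "Y = {..<0}"
proof -
  have down': "z \<in> Y" if "y \<in> Y" "z \<le> y" for y z
    using that(2,1) by (induction rule: int_le_induct) (auto intro: down)
  have neg: "maya {..<0}"
    using maya_beta[of "\<lambda>_. 0"] unfolding beta_0 by (simp add: partitions_def antimono_def)
  consider "{..<0} \<subseteq> Y" | "Y \<subseteq> {..<0}"
    using down' by (meson lessThan_iff less_imp_le not_le order_trans subsetI)
  then show ?thesis
  proof cases
    case 1
    then show ?thesis using maya_not_psubset_shift[OF neg Y, of 0] by auto
  next
    case 2
    then show ?thesis using maya_not_psubset_shift[OF Y neg, of 0] by auto
  qed
qed

lemma empty_mp_in_multipartitions: "empty_mp l \<in> multipartitions l"
  unfolding empty_mp_def multipartitions_def partitions_def by (auto simp: antimono_def)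

text \<open>For modulus 1 the shift by -1 within a component is admissible, so bead sets are
  downward closed. The convention for modulus 1 thus agrees with nestedness.\<close>

lemma nested_1_iff:
  assumes lam: "lam \<in> multipartitions l"
  shows "nested 1 c lam \<longleftrightarrow> lam = empty_mp l"
proof
  have len: "length lam = l" using lam unfolding multipartitions_def by simp
  assume nest: "nested 1 c lam"
  have "lam ! k = (\<lambda>_. 0)" if k: "k < l" for k
  proof -
    have "beta (lam ! k) = beta (\<lambda>_. 0)"
      unfolding beta_0 using nest k
      by (intro maya_downward_closed maya_beta_nth[OF lam k])
        (force simp: nested_def len dest: spec[of _ k] spec[of _ "- 1 :: int"])
    moreover have "(\<lambda>_. 0) \<in> partitions" by (simp add: partitions_def antimono_def)
    ultimately show ?thesis using inj_onD[OF inj_on_beta] multipartitions_nth[OF lam k] by blast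
  qed
  then show "lam = empty_mp l" unfolding empty_mp_def using len by (simp add: nth_equalityI)
next
  assume "lam = empty_mp l"
  then show "nested 1 c lam" unfolding nested_def empty_mp_def by (auto simp: beta_0)
qed

theorem cores_iff_nested:
  assumes "length c = l" "l > 0"
  shows "lam \<in> cores l (s, c) \<longleftrightarrow> lam \<in> multipartitions l \<and> nested s c lam"
proof (cases "s = 1")
  case True
  then show ?thesis
    using nested_1_iff empty_mp_in_multipartitions unfolding cores_def by auto
next
  case False
  then show ?thesis
    using content_nonunique_if_not_nested[of lam l s c] content_unique_if_nested[of lam l c s] assms
    unfolding cores_def by auto
qed

text \<open>A shift congruent to \<open>c' ! j - c' ! i\<close> modulo \<open>s\<close> is congruent
  to \<open>c ! j - c ! i\<close> modulo \<open>m\<close>, so each condition for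
  \<open>(s, c')\<close> is one for \<open>(m, c)\<close>.\<close>

lemma nested_coarsen:
  assumes nest: "nested m c lam" and s: "m dvd s"
    and c': "\<And>i j. i < length lam \<Longrightarrow> j < length lam \<Longrightarrow> int m dvd c ! i - c ! j - c' ! i + c' ! j"
  shows "nested s c' lam"
  unfolding nested_def
proof (intro allI impI ballI)
  fix i j d y
  assume ij: "i < length lam" "j < length lam" and d: "d \<le> 0" "int s dvd d - (c' ! j - c' ! i)"
    and y: "y \<in> beta (lam ! j)"
  have "int m dvd d - (c' ! j - c' ! i)" using d(2) s by (meson dvd_trans int_dvd_int_iff)
  then have "int m dvd d - (c' ! j - c' ! i) - (c ! j - c ! i - c' ! j + c' ! i)"
    using c'[OF ij(2,1)] by (rule dvd_diff)
  then have "int m dvd d - (c ! j - c ! i)" by (simp add: algebra_simps)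
  then show "y + d \<in> beta (lam ! i)" using nest ij d(1) y unfolding nested_def by blast
qed

section \<open>Infinitely many cores\<close>

lemma residue_in_interval:
  fixes a r m :: int
  assumes "m > 0"
  obtains u where "a \<le> u" "u < a + m" "m dvd u - r"
    "\<And>x. a \<le> x \<Longrightarrow> x < a + m \<Longrightarrow> m dvd x - r \<Longrightarrow> x = u"
proof -
  define u where "u = a + (r - a) mod m"
  have u: "a \<le> u" "u < a + m" unfolding u_def using assms by auto
  have "u - r = - (m * ((r - a) div m))"
    unfolding u_def using minus_mult_div_eq_mod[of "r - a" m] by simp
  then have dvd: "m dvd u - r" by simp
  moreover have "x = u" if x: "a \<le> x" "x < a + m" "m dvd x - r" for x
  proof -
    have "m dvd (x - r) - (u - r)" using x(3) dvd by (rule dvd_diff)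
    then have "m dvd x - u" by simp
    moreover have "\<bar>x - u\<bar> < m" using x u by auto
    ultimately show ?thesis using assms by (metis abs_of_pos dvd_imp_le_int eq_iff_diff_eq_0 not_less)
  qed
  ultimately show ?thesis using u that by blast
qed

text \<open>An affine permutation of \<open>\<int>\<close> of period \<open>m\<close>. Since it commutes with translation by \<open>m\<close>,
  its sublevel sets form a nested family.\<close>

definition shear :: "nat \<Rightarrow> nat \<Rightarrow> int \<Rightarrow> int" where
  "shear m n x = (if int m dvd x then x - int n * int m
     else if int m dvd x - 1 then x + int n * int m else x)"

text \<open>Recentring at the threshold \<open>t\<close> gives the sublevel set charge 0;
  \<open>t\<close> will be the charge of a component.\<close>

definition shear_set :: "nat \<Rightarrow> nat \<Rightarrow> int \<Rightarrow> int set" where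
  "shear_set m n t = {y. shear m n (y + t) < t}"

lemma shear_add_multiple: "shear m n (x + int m * q) = shear m n x + int m * q"
proof -
  have "int m dvd x + int m * q - 1 \<longleftrightarrow> int m dvd x - 1"
    using dvd_add_left_iff[of "int m" "int m * q" "x - 1"] by (simp add: algebra_simps)
  then show ?thesis unfolding shear_def by (simp add: dvd_add_left_iff)
qed

text \<open>Passing from \<open>n\<close> to \<open>n + 1\<close> moves one bead: the class of 0
  gains its one member \<open>u\<close> in the interval of length \<open>m\<close> starting at
  \<open>t + n m\<close>, and the class of 1 loses its one member \<open>v\<close> in the interval
  of length \<open>m\<close> ending at \<open>t - n m\<close>.\<close>

lemma maya_shear_set:
  assumes m: "m \<ge> 2"
  shows "maya (shear_set m n t)"
proof (induction n)
  case 0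
  have "shear_set m 0 t = beta (\<lambda>_. 0)" unfolding shear_set_def shear_def beta_0 by auto
  then show ?case using maya_beta[of "\<lambda>_. 0"] by (simp add: partitions_def antimono_def)
next
  case (Suc n)
  have pos: "0 < int m" using m by simp
  let ?G = "int m" and ?N = "int n * int m"
  obtain u where u: "t + ?N \<le> u" "u < t + ?N + ?G" "?G dvd u - 0"
    "\<And>x. t + ?N \<le> x \<Longrightarrow> x < t + ?N + ?G \<Longrightarrow> ?G dvd x - 0 \<Longrightarrow> x = u"
    using residue_in_interval[OF pos, of "t + ?N" 0] by blast
  obtain v where v: "t - ?N - ?G \<le> v" "v < t - ?N - ?G + ?G" "?G dvd v - 1"
    "\<And>x. t - ?N - ?G \<le> x \<Longrightarrow> x < t - ?N - ?G + ?G \<Longrightarrow> ?G dvd x - 1 \<Longrightarrow> x = v"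
    using residue_in_interval[OF pos, of "t - ?N - ?G" 1] by blast
  have not_both: "\<not> (?G dvd x \<and> ?G dvd x - 1)" for x
  proof
    assume "?G dvd x \<and> ?G dvd x - 1"
    then have "?G dvd x - (x - 1)" by (metis dvd_diff)
    then show False using m by simp
  qed
  have step: "shear m (Suc n) x < t \<longleftrightarrow> x = u \<or> shear m n x < t \<and> x \<noteq> v" for x
  proof -
    consider "?G dvd x" "\<not> ?G dvd x - 1" | "\<not> ?G dvd x" "?G dvd x - 1" | "\<not> ?G dvd x" "\<not> ?G dvd x - 1"
      using not_both by blast
    then show ?thesis
    proof cases
      case 1
      then have "x \<noteq> v" using v(3) by auto
      moreover have "x - ?N - ?G < t \<longleftrightarrow> x = u \<or> x - ?N < t" using 1 u(1,2) u(4)[of x] by auto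
      ultimately show ?thesis using 1 by (simp add: shear_def algebra_simps)
    next
      case 2
      then have "x \<noteq> u" using u(3) by auto
      moreover have "t - ?N - ?G \<le> x \<and> x < t - ?N \<longrightarrow> x = v" using 2 v(4)[of x] by simp
      then have "x + ?N + ?G < t \<longleftrightarrow> x + ?N < t \<and> x \<noteq> v" using v(1,2) by arith
      ultimately show ?thesis using 2 by (simp add: shear_def algebra_simps)
    next
      case 3
      then have "x \<noteq> u" "x \<noteq> v" using u(3) v(3) by auto
      then show ?thesis using 3 by (simp add: shear_def)
    qed
  qed
  have "shear_set m (Suc n) t = insert (u - t) (shear_set m n t - {v - t})"
  proof (rule set_eqI)
    fix y
    show "y \<in> shear_set m (Suc n) t \<longleftrightarrow> y \<in> insert (u - t) (shear_set m n t - {v - t})"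
      using step[of "y + t"] by (simp add: shear_set_def eq_diff_eq)
  qed
  moreover have "\<not> ?G dvd v" "?G dvd u" using v(3) u(3) not_both by auto
  then have "v - t \<in> shear_set m n t" "u - t \<notin> shear_set m n t"
    using u(1) v(2,3) unfolding shear_set_def shear_def by simp_all
  ultimately show ?case using maya_swap[OF Suc.IH] by simp
qed

lemma inj_shear_set:
  assumes m: "m \<ge> 2"
  shows "inj (\<lambda>n. shear_set m n t)"
proof (rule linorder_injI)
  fix n n' :: nat assume less: "n < n'"
  have pos: "0 < int m" using m by simp
  obtain u where u: "t + int n * int m \<le> u" "u < t + int n * int m + int m" "int m dvd u - 0"
    using residue_in_interval[OF pos, of "t + int n * int m" 0] by blast
  have "(int n + 1) * int m \<le> int n' * int m" using less by (intro mult_right_mono) auto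
  then have "u < t + int n' * int m" using u(2) by (simp add: algebra_simps)
  then have "u - t \<in> shear_set m n' t" "u - t \<notin> shear_set m n t"
    using u unfolding shear_set_def shear_def by auto
  then show "shear_set m n t \<noteq> shear_set m n' t" by blast
qed

text \<open>All components are sublevel sets of one shear, cut at the thresholds
  \<open>c ! k\<close>; varying \<open>n\<close> gives infinitely many.\<close>

lemma infinite_nested:
  assumes l: "l > 0" and m: "m \<ge> 2"
  shows "infinite {lam \<in> multipartitions l. nested m c lam}"
proof -
  have "\<exists>p. p \<in> partitions \<and> beta p = shear_set m n t" for n t
    using maya_imp_beta[OF maya_shear_set[OF m]] by metis
  then obtain p where p: "\<And>n t. p n t \<in> partitions" "\<And>n t. beta (p n t) = shear_set m n t"
    by metis
  define lam where "lam n = map (\<lambda>k. p n (c ! k)) [0..<l]" for n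
  have "lam n \<in> multipartitions l" for n
    unfolding lam_def multipartitions_def using p(1) by auto
  moreover have "nested m c (lam n)" for n
    unfolding nested_def
  proof (intro allI impI ballI)
    fix i j d y
    assume ij: "i < length (lam n)" "j < length (lam n)" and d: "d \<le> 0" "int m dvd d - (c ! j - c ! i)"
      and y: "y \<in> beta (lam n ! j)"
    obtain q where q: "d = c ! j - c ! i + int m * q"
      using d(2) by (metis add.commute diff_add_cancel dvdE)
    have "shear m n (y + c ! j) < c ! j" using y ij unfolding lam_def by (simp add: p shear_set_def)
    \<comment> \<open>The threshold becomes \<open>c ! j + m q = c ! i + d\<close>, which is at most
      \<open>c ! i\<close>.\<close>
    then have "shear m n (y + c ! j + int m * q) < c ! i"
      using d(1) q by (simp add: shear_add_multiple)
    moreover have "y + c ! j + int m * q = y + d + c ! i" using q by simp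
    ultimately show "y + d \<in> beta (lam n ! i)" using ij unfolding lam_def by (simp add: p shear_set_def)
  qed
  ultimately have "range lam \<subseteq> {lam \<in> multipartitions l. nested m c lam}" by auto
  moreover have "inj lam"
  proof (rule injI)
    fix n n' assume "lam n = lam n'"
    then have "beta (lam n ! 0) = beta (lam n' ! 0)" by simp
    then have "shear_set m n (c ! 0) = shear_set m n' (c ! 0)" using l unfolding lam_def by (simp add: p)
    then show "n = n'" using injD[OF inj_shear_set[OF m]] by blast
  qed
  then have "infinite (range lam)" by (rule range_inj_infinite)
  ultimately show ?thesis using finite_subset by blast
qed

section \<open>Finiteness\<close>

text \<open>Charge 0 confines the beads: one at or above \<open>N\<close> would fill all positions
  up to 0, which is one too many, and a gap below \<open>- N\<close> would leave no bead from -1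
  upwards, which is one too few. Only \<open>{- N..<N}\<close> remains free.\<close>

lemma finite_shift_closed_partitions:
  assumes N: "N \<ge> 0"
  shows "finite {p \<in> partitions. \<forall>h\<ge>N. \<forall>y\<in>beta p. y - h \<in> beta p}" (is "finite ?F")
proof -
  have box: "{..<- N} \<subseteq> beta p \<and> beta p \<subseteq> {..<N}" if p: "p \<in> ?F" for p
  proof -
    let ?Y = "beta p"
    have shift: "z \<in> ?Y" if "y \<in> ?Y" "z \<le> y - N" for y z
    proof -
      have "y - (y - z) \<in> ?Y" using p that by (intro p[simplified, THEN conjunct2, rule_format]) auto
      then show ?thesis by simp
    qed
    have "maya ?Y" using p maya_beta by simp
    then obtain A0 where A0: "\<And>A. A \<ge> A0 \<Longrightarrow> finite (?Y \<inter> {- int A..}) \<and> card (?Y \<inter> {- int A..}) = A"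
      unfolding maya_def eventually_sequentially by auto
    have "y < N" if y: "y \<in> ?Y" for y
    proof (rule ccontr)
      assume "\<not> y < N"
      then have "{- int A0..0} \<subseteq> ?Y \<inter> {- int A0..}" using shift[OF y] by auto
      from card_mono[OF _ this] A0[of A0] show False by simp
    qed
    moreover have "z \<in> ?Y" if z: "z < - N" for z
    proof (rule ccontr)
      assume nz: "z \<notin> ?Y"
      have "y < - 1" if "y \<in> ?Y" for y
        using shift[OF that, of z] nz z by linarith
      then have "?Y \<inter> {- int (Suc A0)..} \<subseteq> {- int (Suc A0)..<- 1}" by auto
      from card_mono[OF _ this] A0[of "Suc A0"] show False by simp
    qed
    ultimately show ?thesis by auto
  qed
  have "beta ` ?F \<subseteq> (\<lambda>V. {..<- N} \<union> V) ` Pow {- N..<N}"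
  proof
    fix Y assume "Y \<in> beta ` ?F"
    then have "{..<- N} \<subseteq> Y" "Y \<subseteq> {..<N}" using box by auto
    then have "Y = {..<- N} \<union> (Y \<inter> {- N..<N})" by auto
    then show "Y \<in> (\<lambda>V. {..<- N} \<union> V) ` Pow {- N..<N}" by blast
  qed
  then have "finite (beta ` ?F)" by (rule finite_subset) simp
  moreover have "inj_on beta ?F" using inj_on_beta by (rule inj_on_subset) auto
  ultimately show ?thesis by (rule finite_imageD)
qed

text \<open>Closing up a path from component \<open>i\<close> through component \<open>j\<close> back to \<open>i\<close>, with one step taken
  for the datum \<open>(s|c)\<close> and the other for \<open>(r|d)\<close>, yields a shift that maps the beads of component
  \<open>i\<close> into themselves. As \<open>r > 0\<close>, the step for \<open>(r|d)\<close> can be made negative.\<close>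

lemma nested_loop:
  assumes nest: "nested s c lam" "nested r d lam" and r: "r > 0"
    and ij: "i < length lam" "j < length lam" and y: "y \<in> beta (lam ! i)"
  defines "M \<equiv> \<bar>d ! i - d ! j\<bar>"
  shows "c ! j \<le> c ! i \<Longrightarrow> y - (- (c ! j - c ! i - (d ! j - d ! i)) + int r * M) \<in> beta (lam ! i)"
    and "c ! i \<le> c ! j \<Longrightarrow> y - (c ! j - c ! i - (d ! j - d ! i) + int r * M) \<in> beta (lam ! i)"
proof -
  have "1 * M \<le> int r * M" using r unfolding M_def by (intro mult_right_mono) auto
  moreover have "d ! i - d ! j \<le> M" "d ! j - d ! i \<le> M" unfolding M_def by auto
  ultimately have neg: "d ! i - d ! j - int r * M \<le> 0" "d ! j - d ! i - int r * M \<le> 0"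
    by simp_all
  note step = nest[unfolded nested_def, rule_format]
  {
    \<comment> \<open>The step for \<open>(s, c)\<close> must be nonpositive too, so the sign of
      \<open>c ! j - c ! i\<close> decides whether it is the way out or the way back.\<close>
    assume le: "c ! j \<le> c ! i"
    have "y + (d ! i - d ! j - int r * M) \<in> beta (lam ! j)"
      using step(2)[OF ij(2,1) neg(1) _ y] by simp
    then have "y + (d ! i - d ! j - int r * M) + (c ! j - c ! i) \<in> beta (lam ! i)"
      using step(1)[OF ij, of "c ! j - c ! i"] le by simp
    then show "y - (- (c ! j - c ! i - (d ! j - d ! i)) + int r * M) \<in> beta (lam ! i)"
      by (simp add: algebra_simps)
  }
  {
    assume le: "c ! i \<le> c ! j"
    have "y + (c ! i - c ! j) \<in> beta (lam ! j)"
      using step(1)[OF ij(2,1) _ _ y, of "c ! i - c ! j"] le by simp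
    then have "y + (c ! i - c ! j) + (d ! j - d ! i - int r * M) \<in> beta (lam ! i)"
      using step(2)[OF ij neg(2)] by simp
    then show "y - (c ! j - c ! i - (d ! j - d ! i) + int r * M) \<in> beta (lam ! i)"
      by (simp add: algebra_simps)
  }
qed

text \<open>A numerical semigroup argument: the residues of \<open>H\<close> modulo \<open>s\<close>
  form a group containing those of \<open>A\<close>, hence that of 1. Adding copies of
  \<open>s\<close> then reaches every large integer.\<close>

lemma additive_set_eventually_all:
  fixes H :: "int set"
  assumes zero: "0 \<in> H" and add: "\<And>x y. x \<in> H \<Longrightarrow> y \<in> H \<Longrightarrow> x + y \<in> H"
    and s: "s > 0" "s \<in> H"
    and A: "\<And>x. x \<in> A \<Longrightarrow> \<exists>M. x + s * M \<in> H \<or> - x + s * M \<in> H" and gcd: "Gcd A = 1"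
  obtains N where "N \<ge> 0" "\<And>h. h \<ge> N \<Longrightarrow> h \<in> H"
proof -
  have mult: "n * x \<in> H" if "x \<in> H" "n \<ge> 0" for n x :: int
    using that(2)
  proof (induction n rule: int_ge_induct)
    case (step i)
    have "i * x + x \<in> H" using add[OF step.IH that(1)] .
    then show ?case by (simp add: algebra_simps)
  qed (use zero in simp)
  define K where "K = {x. \<exists>M. x + s * M \<in> H}"
  have neg: "- x \<in> K" if x: "x \<in> K" for x
  proof -
    obtain M where "x + s * M \<in> H" using x unfolding K_def by auto
    \<comment> \<open>The nonnegative factor \<open>s - 1\<close> stands for -1 modulo
      \<open>s\<close>.\<close>
    then have "(s - 1) * (x + s * M) \<in> H" using s by (intro mult) auto
    then have "- x + s * (x + (s - 1) * M) \<in> H" by (simp add: algebra_simps)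
    then show ?thesis unfolding K_def by blast
  qed
  have "x \<in> K" if "x \<in> group_closure A" for x
    using that
  proof induction
    case (base x)
    have "0 + s * 0 \<in> H" using zero by simp
    then have "0 \<in> K" unfolding K_def by blast
    moreover have "x \<in> K" if "x \<in> A" using A[OF that] neg[of "- x"] unfolding K_def by auto
    ultimately show ?case using base by auto
  next
    case (diff x y)
    then obtain M M' where "x + s * M \<in> H" "- y + s * M' \<in> H"
      using neg[of y] unfolding K_def by auto
    from add[OF this] have "x - y + s * (M + M') \<in> H" by (simp add: algebra_simps)
    then show ?case unfolding K_def by blast
  qed
  then have "1 \<in> K" using Gcd_in_group_closure[of A] gcd by simp
  then obtain M where M: "1 + s * M \<in> H" unfolding K_def by auto
  show ?thesis
  proof
    \<comment> \<open>Beyond this bound the coefficient \<open>q - r * M\<close> of \<open>s\<close>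
      in the decomposition of \<open>h\<close> is nonnegative.\<close>
    show "0 \<le> s * (s * \<bar>M\<bar>)" using s by simp
    fix h assume h: "h \<ge> s * (s * \<bar>M\<bar>)"
    define q r where "q = h div s" and "r = h mod s"
    have "0 \<le> r" "r < s" using s unfolding r_def by auto
    have "s * \<bar>M\<bar> \<le> q" using h s unfolding q_def
      by (metis nonzero_mult_div_cancel_left order_less_irrefl zdiv_mono1)
    moreover have "r * M \<le> r * \<bar>M\<bar>" using \<open>0 \<le> r\<close> by (intro mult_left_mono) auto
    moreover have "r * \<bar>M\<bar> \<le> s * \<bar>M\<bar>" using \<open>r < s\<close> by (intro mult_right_mono) auto
    ultimately have "r * (1 + s * M) + (q - r * M) * s \<in> H"
      by (intro add[OF mult[OF M \<open>0 \<le> r\<close>] mult[OF s(2)]]) simp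
    moreover have "h = r + s * q" unfolding q_def r_def by simp
    ultimately show "h \<in> H" by (simp add: algebra_simps)
  qed
qed

text \<open>For each component, the downward shifts preserving its beads form an additive set
  containing all moduli and loop shifts. Coprimality makes it contain all large integers.\<close>

lemma finite_nested_if_coprime:
  assumes T: "T \<subseteq> mp_data l" and t0: "(r, d) \<in> T" "r > 0" and gcd: "g l T = 1"
  shows "finite {lam \<in> multipartitions l. \<forall>(s, c)\<in>T. nested s c lam}" (is "finite ?C")
proof -
  have len: "length lam = l" if "lam \<in> ?C" for lam using that unfolding multipartitions_def by simp
  have nest: "nested s c lam" if "lam \<in> ?C" "(s, c) \<in> T" for lam s c using that by auto
  have "finite ((\<lambda>lam. lam ! i) ` ?C)" if i: "i < l" for i
  proof -
    \<comment> \<open>Quantifying over all \<open>lam\<close> at once makes the resulting bound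
      \<open>N\<close> uniform.\<close>
    define H where "H = {h. \<forall>lam\<in>?C. \<forall>y\<in>beta (lam ! i). y - h \<in> beta (lam ! i)}"
    have zero: "0 \<in> H" unfolding H_def by simp
    have add: "x + y \<in> H" if x: "x \<in> H" and y: "y \<in> H" for x y
      unfolding H_def
    proof (intro CollectI ballI)
      fix lam z assume "lam \<in> ?C" "z \<in> beta (lam ! i)"
      then have "z - x - y \<in> beta (lam ! i)" using x y unfolding H_def by blast
      then show "z - (x + y) \<in> beta (lam ! i)" by (simp add: algebra_simps)
    qed
    have period: "int s \<in> H" if "(s, c) \<in> T" for s c
      unfolding H_def
    proof (intro CollectI ballI)
      fix lam y assume lam: "lam \<in> ?C" and y: "y \<in> beta (lam ! i)"
      show "y - int s \<in> beta (lam ! i)"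
        using nest[OF lam that, unfolded nested_def, rule_format, of i i "- int s" y] i y len[OF lam] by simp
    qed
    define e where "e c j = c ! j - c ! i - (d ! j - d ! i)" for c :: "int list" and j
    have loop: "\<exists>M. e c j + int r * M \<in> H \<or> - e c j + int r * M \<in> H" if c: "(s, c) \<in> T" and j: "j < l" for s c j
    proof (cases "c ! j \<le> c ! i")
      case True
      then have "- e c j + int r * \<bar>d ! i - d ! j\<bar> \<in> H"
        unfolding H_def e_def using nested_loop(1)[OF nest[OF _ c] nest[OF _ t0(1)] t0(2)] i j len
        by auto
      then show ?thesis by blast
    next
      case False
      then have "e c j + int r * \<bar>d ! i - d ! j\<bar> \<in> H"
        unfolding H_def e_def using nested_loop(2)[OF nest[OF _ c] nest[OF _ t0(1)] t0(2)] i j len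
        by auto
      then show ?thesis by blast
    qed
    define A where "A = {int s | s c. (s, c) \<in> T} \<union> {e c j | s c j. (s, c) \<in> T \<and> j < l}"
    have "Gcd A dvd g l T"
      unfolding g_def
    proof (rule Gcd_greatest)
      fix x assume "x \<in> {int s | s c. (s, c) \<in> T} \<union>
        {c ! i - c ! j - d ! i + d ! j | s c r d i j. (s, c) \<in> T \<and> (r, d) \<in> T \<and> i < l \<and> j < l}"
      then consider s c where "x = int s" "(s, c) \<in> T"
        | s c s' c' p q where "x = c ! p - c ! q - c' ! p + c' ! q" "(s, c) \<in> T" "(s', c') \<in> T" "p < l" "q < l"
        by blast
      then show "Gcd A dvd x"
      proof cases
        case 1
        then show ?thesis unfolding A_def by (intro Gcd_dvd) blast
      next
        case 2
        have "Gcd A dvd e c p" "Gcd A dvd e c q" "Gcd A dvd e c' p" "Gcd A dvd e c' q"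
          unfolding A_def using 2 by (auto intro!: Gcd_dvd)
        \<comment> \<open>The normalizations cancel in the double difference, leaving a defining
          integer of \<open>g\<close>.\<close>
        then have "Gcd A dvd (e c p - e c q) - (e c' p - e c' q)" by (intro dvd_diff)
        also have "(e c p - e c q) - (e c' p - e c' q) = x" unfolding e_def 2(1) by simp
        finally show ?thesis .
      qed
    qed
    then have "Gcd A = 1" using gcd by simp
    moreover have "\<exists>M. x + int r * M \<in> H \<or> - x + int r * M \<in> H" if x: "x \<in> A" for x
    proof -
      consider s c where "x = int s" "(s, c) \<in> T" | s c j where "x = e c j" "(s, c) \<in> T" "j < l"
        using x unfolding A_def by blast
      then show ?thesis
      proof cases
        case 1
        then have "x + int r * 0 \<in> H" using period by simp
        then show ?thesis by blast
      next
        case 2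
        then show ?thesis using loop by blast
      qed
    qed
    ultimately obtain N where N: "N \<ge> 0" "\<And>h. h \<ge> N \<Longrightarrow> h \<in> H"
      using additive_set_eventually_all[OF zero add _ period[OF t0(1)], of A] t0(2) by auto
    have "(\<lambda>lam. lam ! i) ` ?C \<subseteq> {p \<in> partitions. \<forall>h\<ge>N. \<forall>y\<in>beta p. y - h \<in> beta p}"
      using N(2) multipartitions_nth[OF _ i] unfolding H_def by auto
    then show ?thesis using finite_shift_closed_partitions[OF N(1)] by (rule finite_subset)
  qed
  then have "finite (\<Union>i<l. (\<lambda>lam. lam ! i) ` ?C)" by simp
  then have "finite {lam. set lam \<subseteq> (\<Union>i<l. (\<lambda>lam. lam ! i) ` ?C) \<and> length lam = l}"
    by (rule finite_lists_length_eq)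
  moreover have "?C \<subseteq> {lam. set lam \<subseteq> (\<Union>i<l. (\<lambda>lam. lam ! i) ` ?C) \<and> length lam = l}"
    using len by (force simp: in_set_conv_nth)
  ultimately show ?thesis using finite_subset by blast
qed

theorem theorem3p14:
  fixes l :: nat and T :: "mp_datum set"
  assumes "l > 0"
    and "T \<subseteq> mp_data l"
    and "\<exists>(s, c) \<in> T. s > 0"
  shows "finite (simultaneous_cores l T) \<longleftrightarrow> g l T = 1"
proof -
  obtain r d where rd: "(r, d) \<in> T" "r > 0" using assms(3) by auto
  have core_iff: "lam \<in> cores l (s, c) \<longleftrightarrow> lam \<in> multipartitions l \<and> nested s c lam"
    if "(s, c) \<in> T" for lam s c
    using cores_iff_nested assms(1,2) that unfolding mp_data_def by auto
  have C: "simultaneous_cores l T = {lam \<in> multipartitions l. \<forall>(s, c)\<in>T. nested s c lam}"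
    unfolding simultaneous_cores_def using rd(1) by (auto simp: core_iff split: prod.splits)
  show ?thesis
  proof
    assume "g l T = 1"
    then show "finite (simultaneous_cores l T)"
      unfolding C by (rule finite_nested_if_coprime[OF assms(2) rd])
  next
    assume fin: "finite (simultaneous_cores l T)"
    define m where "m = nat (g l T)"
    have gm: "g l T = int m" unfolding m_def g_def by simp
    have s: "m dvd s" if "(s, c) \<in> T" for s c
    proof -
      have "g l T dvd int s" unfolding g_def using that by (intro Gcd_dvd) blast
      then show ?thesis unfolding gm by simp
    qed
    have c: "int m dvd d ! i - d ! j - c ! i + c ! j" if "(s, c) \<in> T" "i < l" "j < l" for s c i j
      unfolding gm[symmetric] g_def using that rd(1) by (intro Gcd_dvd) blast
    \<comment> \<open>As \<open>m\<close> divides every integer defining \<open>g\<close>,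
      nestedness for the single datum \<open>(m, d)\<close> implies it for all data in
      \<open>T\<close>.\<close>
    have "nested s c lam" if "(s, c) \<in> T" "lam \<in> multipartitions l" "nested m d lam" for s c lam
      using nested_coarsen[OF that(3) s[OF that(1)]] c[OF that(1)] that(2)
      unfolding multipartitions_def by auto
    then have "{lam \<in> multipartitions l. nested m d lam} \<subseteq> simultaneous_cores l T"
      unfolding C by auto
    then have "finite {lam \<in> multipartitions l. nested m d lam}" using fin by (rule finite_subset)
    then have "\<not> m \<ge> 2" using infinite_nested[OF assms(1)] by blast
    moreover have "m \<noteq> 0" using s[OF rd(1)] rd(2) by auto
    ultimately have "m = 1" by simp
    then show "g l T = 1" using gm by simp
  qed
qed

end
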